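(* Let $\mathcal S$ be a complete separable metric space, $\mu$ a boundedly finite Borel measure on $\mathcal S$, $m\ge2$ an integer and $a,\rho,k>0$. Let $N$ be a multivariate generalized Waring process with parameters $a,k,\rho$ and parameter measure $\mu$, and for $i\in\{1,\dots,m\}$ let $N_i(\cdot)=N(\cdot\times\{i\})$. Then: (1) for every $i$, $N_i$ is a generalized Waring process on $\mathcal S$ with parameters $a,k,\rho$ and parameter measure $\mu$; (2) for distinct indices $i_1,\dots,i_l\in\{1,\dots,m\}$, $\sum_{j=1}^lN_{i_j}$ is a generalized Waring process on $\mathcal S$ with parameters $a,\rho$, $k$ and parameter measure $l\mu$ (so that $\sum_j N_{i_j}(A)$ has the $\mathrm{GWD}(a,kl\mu(A);\rho)$ distribution for bounded Borel $A$); (3) for distinct indices $i_1,\dots,i_l\in\{1,\dots,m\}$, the process $(N_{i_1},\dots,N_{i_l})$ is a multivariate generalized Waring process (with $l$ components) with parameters $a,k,\rho$ and parameter measure $\mu$; in particular for all bounded Borel sets $A_1,\dots,A_l\subset\mathcal S$, $(N_{i_1}(A_1),\dots,N_{i_l}(A_l))$ has the $\mathrm{MGWD}(a;k\mu(A_1),\dots,k\mu(A_l);\rho)$ distribution; (4) for every $i$ and all bounded Borel sets $A,B\subset\mathcal S$, $(N_i(A),\sum_{j\ne i}N_j(B))$ has the $\mathrm{MGWD}(a;k\mu(A),(m-1)k\mu(B);\rho)$ (bivariate generalized Waring) distribution.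
   Context: For $x>0$, $\beta\ge0$ write $x_{(\beta)}=\Gamma(x+\beta)/\Gamma(x)$, with $0_{(0)}=1$ and $0_{(n)}=0$ for integers $n\ge1$. For $a,\rho>0$ and $k_1,\dots,k_s\ge 0$, $\mathrm{MGWD}(a;k_1,\dots,k_s;\rho)$ denotes the law on $\{0,1,2,\dots\}^s$ with $P(X_i=x_i,\ i=1,\dots,s)=\frac{\rho_{(\sum_i k_i)}\,a_{(\sum_i x_i)}}{(\rho+a)_{(\sum_i k_i+\sum_i x_i)}}\prod_{i=1}^s\frac{(k_i)_{(x_i)}}{x_i!}$; for $s=1$ it is $\mathrm{GWD}(a,k_1;\rho)$. A point process $N$ on a complete separable metric space $\mathcal S$ is a generalized Waring process with parameters $a,\rho,k>0$ and parameter measure $\mu$ (a boundedly finite Borel measure) if for every finite family of pairwise disjoint bounded Borel sets $A_1,\dots,A_l$, $(N(A_1),\dots,N(A_l))$ has the $\mathrm{MGWD}(a;k\mu(A_1),\dots,k\mu(A_l);\rho)$ distribution. Let $\nu$ be the Borel measure on $\mathcal S\times\{1,\dots,m\}$ given by $\nu(A\times C)=\mu(A)\cdot|C|$ for Borel $A\subset\mathcal S$ and $C\subset\{1,\dots,m\}$ (i.e. $\nu(A\times\{i\})=\mu(A)$). A multivariate generalized Waring process on $\mathcal S$ with parameters $a,k,\rho$ and parameter measure $\mu$ is a generalized Waring process on $\mathcal S\times\{1,\dots,m\}$ with parameters $a,k,\rho$ and parameter measure $\nu$. *)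

theory Defs
  imports "HOL-Probability.Probability"
begin

definition rising :: "real \<Rightarrow> real \<Rightarrow> real" where
  "rising x \<beta> = (if x = 0 then (if \<beta> = 0 then 1 else 0) else Gamma (x + \<beta>) / Gamma x)"

definition mgwd_pmf :: "real \<Rightarrow> real \<Rightarrow> nat \<Rightarrow> (nat \<Rightarrow> real) \<Rightarrow> (nat \<Rightarrow> nat) \<Rightarrow> real" where
  "mgwd_pmf a \<rho> s k x =
     rising \<rho> (\<Sum>i\<in>{1..s}. k i) * rising a (real (\<Sum>i\<in>{1..s}. x i))
     / rising (\<rho> + a) ((\<Sum>i\<in>{1..s}. k i) + real (\<Sum>i\<in>{1..s}. x i))
     * (\<Prod>i\<in>{1..s}. rising (k i) (real (x i)) / fact (x i))"

definition has_mgwd :: "'w measure \<Rightarrow> real \<Rightarrow> real \<Rightarrow> nat \<Rightarrow> (nat \<Rightarrow> real) \<Rightarrow> (nat \<Rightarrow> 'w \<Rightarrow> nat) \<Rightarrow> bool" where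
  "has_mgwd M a \<rho> s k X \<longleftrightarrow>
     (\<forall>i\<in>{1..s}. X i \<in> measurable M (count_space UNIV)) \<and>
     (\<forall>x :: nat \<Rightarrow> nat. measure M {\<omega>\<in>space M. \<forall>i\<in>{1..s}. X i \<omega> = x i} = mgwd_pmf a \<rho> s k x)"

definition point_process_on :: "'b::metric_space set \<Rightarrow> 'w measure \<Rightarrow> ('w \<Rightarrow> 'b set \<Rightarrow> nat) \<Rightarrow> bool" where
  "point_process_on X M N \<longleftrightarrow>
     prob_space M \<and>
     (\<forall>A. A \<in> sets borel \<and> bounded A \<and> A \<subseteq> X \<longrightarrow> (\<lambda>\<omega>. N \<omega> A) \<in> measurable M (count_space UNIV)) \<and>
     (\<forall>\<omega>\<in>space M. N \<omega> {} = 0 \<and>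
        (\<forall>F :: nat \<Rightarrow> 'b set. disjoint_family F \<and> range F \<subseteq> sets borel \<and> (\<Union>(range F)) \<subseteq> X
             \<and> bounded (\<Union>(range F)) \<longrightarrow>
           (\<lambda>n. real (N \<omega> (F n))) sums real (N \<omega> (\<Union>(range F)))))"

text \<open>Generalized Waring process on X with parameters a, k, rho and parameter measure nu
  (nu given as its real-valued set function on bounded Borel sets).\<close>
definition gw_process_on :: "'b::metric_space set \<Rightarrow> 'w measure \<Rightarrow> real \<Rightarrow> real \<Rightarrow> real \<Rightarrow> ('b set \<Rightarrow> real)
     \<Rightarrow> ('w \<Rightarrow> 'b set \<Rightarrow> nat) \<Rightarrow> bool" where
  "gw_process_on X M a k \<rho> \<nu> N \<longleftrightarrow>
     point_process_on X M N \<and>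
     (\<forall>(l::nat) (A :: nat \<Rightarrow> 'b set).
        (\<forall>i\<in>{1..l}. A i \<in> sets borel \<and> bounded (A i) \<and> A i \<subseteq> X) \<and> disjoint_family_on A {1..l} \<longrightarrow>
        has_mgwd M a \<rho> l (\<lambda>i. k * \<nu> (A i)) (\<lambda>i \<omega>. N \<omega> (A i)))"

text \<open>Multivariate generalized Waring process on S with marks {1..m}: a GW process on
  S \<times> {1..m} (marks embedded in the reals, since nat carries no metric in the library) with parameter measure nu(B) = sum_i mu({x. (x,i) \<in> B}), so nu(A \<times> {i}) = mu(A).\<close>
definition mark_measure :: "nat \<Rightarrow> 'a measure \<Rightarrow> ('a \<times> real) set \<Rightarrow> real" where
  "mark_measure m \<mu> B = (\<Sum>i\<in>{1..m}. measure \<mu> {x. (x, real i) \<in> B})"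

definition mgw_process :: "nat \<Rightarrow> 'w measure \<Rightarrow> real \<Rightarrow> real \<Rightarrow> real \<Rightarrow> 'a::metric_space measure
     \<Rightarrow> ('w \<Rightarrow> ('a \<times> real) set \<Rightarrow> nat) \<Rightarrow> bool" where
  "mgw_process m M a k \<rho> \<mu> N \<longleftrightarrow> gw_process_on (UNIV \<times> (real ` {1..m})) M a k \<rho> (mark_measure m \<mu>) N"

end

theory Submission
  imports Defs
begin

text \<open>The multivariate process \<open>N\<close> is a generalized Waring process on \<open>S \<times> {1..m}\<close> whose
  parameter measure gives \<open>A \<times> T\<close> the mass \<open>card T \<cdot> \<mu> A\<close>. Each process in the theorem is
  \<open>N\<close> composed with a set map (\<open>A \<mapsto> A \<times> T\<close>, or a relabelling of the marks) that sends bounded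
  Borel sets to bounded Borel sets and preserves disjointness and countable unions; such a map
  transports the defining joint laws of \<open>N\<close> verbatim, with the parameter measure pulled back.
  Finite additivity of \<open>N\<close> then identifies the count of \<open>A \<times> T\<close> with the sum of the counts of
  \<open>A \<times> {i}\<close>, \<open>i \<in> T\<close>.\<close>

lemma Times_in_borel:
  fixes A :: "'a::second_countable_topology set" and B :: "'b::second_countable_topology set"
  assumes "A \<in> sets borel" "B \<in> sets borel"
  shows "A \<times> B \<in> sets borel"
proof -
  have "A \<times> B \<in> sets (borel \<Otimes>\<^sub>M borel)" using assms by auto
  then show ?thesis by (metis borel_prod)
qed

lemma Pair_slice_in_borel:
  fixes B :: "('a::topological_space \<times> 'b::topological_space) set"
  assumes "B \<in> sets borel"
  shows "{x. (x, c) \<in> B} \<in> sets borel"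
proof -
  have "(\<lambda>x. (x, c)) \<in> borel_measurable borel"
    by (intro borel_measurable_continuous_onI continuous_intros)
  from measurable_sets[OF this assms] show ?thesis by (simp add: vimage_def)
qed

lemma has_mgwd_cong:
  assumes "has_mgwd M a \<rho> s k X"
    and "\<And>i. i \<in> {1..s} \<Longrightarrow> k' i = k i"
    and "\<And>i \<omega>. i \<in> {1..s} \<Longrightarrow> \<omega> \<in> space M \<Longrightarrow> X' i \<omega> = X i \<omega>"
  shows "has_mgwd M a \<rho> s k' X'"
proof -
  have "X' i \<in> measurable M (count_space UNIV)" if "i \<in> {1..s}" for i
    using assms(1) that measurable_cong[of M "X' i" "X i"] assms(3)
    unfolding has_mgwd_def by auto
  moreover have "mgwd_pmf a \<rho> s k' x = mgwd_pmf a \<rho> s k x" for x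
    unfolding mgwd_pmf_def using assms(2) by simp
  moreover have "{\<omega>\<in>space M. \<forall>i\<in>{1..s}. X' i \<omega> = x i} = {\<omega>\<in>space M. \<forall>i\<in>{1..s}. X i \<omega> = x i}" for x
    using assms(3) by auto
  ultimately show ?thesis using assms(1) unfolding has_mgwd_def by simp
qed

lemma point_process_onI:
  assumes "prob_space M"
    and "\<And>A. A \<in> sets borel \<Longrightarrow> bounded A \<Longrightarrow> A \<subseteq> X \<Longrightarrow> (\<lambda>\<omega>. N \<omega> A) \<in> measurable M (count_space UNIV)"
    and "\<And>\<omega>. \<omega> \<in> space M \<Longrightarrow> N \<omega> {} = 0"
    and "\<And>\<omega> F. \<omega> \<in> space M \<Longrightarrow> disjoint_family F \<Longrightarrow> range F \<subseteq> sets borel \<Longrightarrow>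
           \<Union>(range F) \<subseteq> X \<Longrightarrow> bounded (\<Union>(range F)) \<Longrightarrow>
           (\<lambda>n. real (N \<omega> (F n))) sums real (N \<omega> (\<Union>(range F)))"
  shows "point_process_on X M N"
  using assms unfolding point_process_on_def by blast

lemma
  assumes "point_process_on X M N"
  shows point_process_on_prob_space: "prob_space M"
    and point_process_on_measurable: "A \<in> sets borel \<Longrightarrow> bounded A \<Longrightarrow> A \<subseteq> X \<Longrightarrow>
          (\<lambda>\<omega>. N \<omega> A) \<in> measurable M (count_space UNIV)"
    and point_process_on_empty: "\<omega> \<in> space M \<Longrightarrow> N \<omega> {} = 0"
    and point_process_on_sums: "\<omega> \<in> space M \<Longrightarrow> disjoint_family F \<Longrightarrow> range F \<subseteq> sets borel \<Longrightarrow>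
          \<Union>(range F) \<subseteq> X \<Longrightarrow> bounded (\<Union>(range F)) \<Longrightarrow>
          (\<lambda>n. real (N \<omega> (F n))) sums real (N \<omega> (\<Union>(range F)))"
  using assms unfolding point_process_on_def by blast+

lemma gw_process_onI:
  assumes "point_process_on X M N"
    and "\<And>l A. (\<And>i. i \<in> {1..l} \<Longrightarrow> A i \<in> sets borel \<and> bounded (A i) \<and> A i \<subseteq> X) \<Longrightarrow>
           disjoint_family_on A {1..l} \<Longrightarrow> has_mgwd M a \<rho> l (\<lambda>i. k * \<nu> (A i)) (\<lambda>i \<omega>. N \<omega> (A i))"
  shows "gw_process_on X M a k \<rho> \<nu> N"
  using assms unfolding gw_process_on_def by blast

lemma
  assumes "gw_process_on X M a k \<rho> \<nu> N"
  shows gw_process_on_point_process: "point_process_on X M N"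
    and gw_process_on_has_mgwd: "(\<And>i. i \<in> {1..l} \<Longrightarrow> A i \<in> sets borel \<and> bounded (A i) \<and> A i \<subseteq> X) \<Longrightarrow>
          disjoint_family_on A {1..l} \<Longrightarrow> has_mgwd M a \<rho> l (\<lambda>i. k * \<nu> (A i)) (\<lambda>i \<omega>. N \<omega> (A i))"
  using assms unfolding gw_process_on_def by blast+

lemma point_process_on_cong:
  assumes "point_process_on X M N"
    and "\<And>\<omega> A. \<omega> \<in> space M \<Longrightarrow> A \<in> sets borel \<Longrightarrow> bounded A \<Longrightarrow> A \<subseteq> X \<Longrightarrow> N' \<omega> A = N \<omega> A"
  shows "point_process_on X M N'"
proof (rule point_process_onI)
  show "prob_space M" using assms(1) by (rule point_process_on_prob_space)
  show "(\<lambda>\<omega>. N' \<omega> A) \<in> measurable M (count_space UNIV)"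
    if "A \<in> sets borel" "bounded A" "A \<subseteq> X" for A
    using point_process_on_measurable[OF assms(1) that] assms(2)[OF _ that]
    by (simp cong: measurable_cong)
  show "N' \<omega> {} = 0" if "\<omega> \<in> space M" for \<omega>
    using assms that point_process_on_empty by fastforce
  fix \<omega> and F :: "nat \<Rightarrow> _"
  assume \<omega>: "\<omega> \<in> space M" and F: "disjoint_family F" "range F \<subseteq> sets borel"
    "\<Union>(range F) \<subseteq> X" "bounded (\<Union>(range F))"
  have "N' \<omega> (F n) = N \<omega> (F n)" for n
    using F by (intro assms(2)[OF \<omega>]) (auto intro: bounded_subset)
  moreover have "N' \<omega> (\<Union>(range F)) = N \<omega> (\<Union>(range F))"
    using F by (intro assms(2)[OF \<omega>]) auto
  ultimately show "(\<lambda>n. real (N' \<omega> (F n))) sums real (N' \<omega> (\<Union>(range F)))"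
    using point_process_on_sums[OF assms(1) \<omega> F] by simp
qed

lemma gw_process_on_cong:
  assumes "gw_process_on X M a k \<rho> \<nu> N"
    and "\<And>\<omega> A. \<omega> \<in> space M \<Longrightarrow> A \<in> sets borel \<Longrightarrow> bounded A \<Longrightarrow> A \<subseteq> X \<Longrightarrow> N' \<omega> A = N \<omega> A"
    and "\<And>A. A \<in> sets borel \<Longrightarrow> bounded A \<Longrightarrow> A \<subseteq> X \<Longrightarrow> \<nu>' A = \<nu> A"
  shows "gw_process_on X M a k \<rho> \<nu>' N'"
proof (rule gw_process_onI)
  show "point_process_on X M N'"
    using gw_process_on_point_process[OF assms(1)] assms(2) by (rule point_process_on_cong)
  fix l and A :: "nat \<Rightarrow> _"
  assume A: "\<And>i. i \<in> {1..l} \<Longrightarrow> A i \<in> sets borel \<and> bounded (A i) \<and> A i \<subseteq> X"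
    and "disjoint_family_on A {1..l}"
  then have "has_mgwd M a \<rho> l (\<lambda>i. k * \<nu> (A i)) (\<lambda>i \<omega>. N \<omega> (A i))"
    by (rule gw_process_on_has_mgwd[OF assms(1)])
  then show "has_mgwd M a \<rho> l (\<lambda>i. k * \<nu>' (A i)) (\<lambda>i \<omega>. N' \<omega> (A i))"
    by (rule has_mgwd_cong) (use A assms(2,3) in auto)
qed

lemma point_process_on_finite_UN:
  fixes G :: "nat \<Rightarrow> 'b::metric_space set"
  assumes "point_process_on X M N" "\<omega> \<in> space M" "finite I" "disjoint_family_on G I"
    and "\<And>i. i \<in> I \<Longrightarrow> G i \<in> sets borel \<and> bounded (G i) \<and> G i \<subseteq> X"
  shows "N \<omega> (\<Union>i\<in>I. G i) = (\<Sum>i\<in>I. N \<omega> (G i))"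
proof -
  define F where "F n = (if n \<in> I then G n else {})" for n
  have U: "\<Union>(range F) = (\<Union>i\<in>I. G i)" unfolding F_def by auto
  have "(\<lambda>n. real (N \<omega> (F n))) sums real (N \<omega> (\<Union>(range F)))"
  proof (rule point_process_on_sums[OF assms(1,2)])
    show "disjoint_family F" using assms(4) unfolding F_def disjoint_family_on_def by auto
    show "range F \<subseteq> sets borel" "\<Union>(range F) \<subseteq> X" "bounded (\<Union>(range F))"
      unfolding U using assms(3,5) by (auto simp: F_def)
  qed
  moreover have "(\<lambda>n. real (N \<omega> (F n))) sums (\<Sum>n\<in>I. real (N \<omega> (F n)))"
    by (rule sums_finite) (use assms(3) point_process_on_empty[OF assms(1,2)] in \<open>auto simp: F_def\<close>)
  ultimately have "real (N \<omega> (\<Union>(range F))) = (\<Sum>n\<in>I. real (N \<omega> (G n)))"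
    by (simp add: sums_unique2 F_def)
  then show ?thesis unfolding U by (metis of_nat_eq_iff of_nat_sum)
qed

lemma gw_process_on_set_map:
  fixes \<phi> :: "'c::metric_space set \<Rightarrow> 'b::metric_space set"
  assumes N: "gw_process_on X M a k \<rho> \<nu> N"
    and \<phi>_borel: "\<And>A. A \<in> sets borel \<Longrightarrow> bounded A \<Longrightarrow> A \<subseteq> Y \<Longrightarrow> \<phi> A \<in> sets borel"
    and \<phi>_bounded: "\<And>A. A \<in> sets borel \<Longrightarrow> bounded A \<Longrightarrow> A \<subseteq> Y \<Longrightarrow> bounded (\<phi> A)"
    and \<phi>_subset: "\<And>A. A \<in> sets borel \<Longrightarrow> bounded A \<Longrightarrow> A \<subseteq> Y \<Longrightarrow> \<phi> A \<subseteq> X"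
    and \<nu>': "\<And>A. A \<in> sets borel \<Longrightarrow> bounded A \<Longrightarrow> A \<subseteq> Y \<Longrightarrow> \<nu>' A = \<nu> (\<phi> A)"
    and \<phi>_disjoint: "\<And>A B. A \<inter> B = {} \<Longrightarrow> \<phi> A \<inter> \<phi> B = {}"
    and \<phi>_UN: "\<And>F :: nat \<Rightarrow> 'c set. \<phi> (\<Union>(range F)) = (\<Union>n. \<phi> (F n))"
  shows "gw_process_on Y M a k \<rho> \<nu>' (\<lambda>\<omega> A. N \<omega> (\<phi> A))"
proof (rule gw_process_onI)
  note P = gw_process_on_point_process[OF N]
  have admissible: "\<phi> A \<in> sets borel \<and> bounded (\<phi> A) \<and> \<phi> A \<subseteq> X"
    if "A \<in> sets borel" "bounded A" "A \<subseteq> Y" for A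
    using that \<phi>_borel \<phi>_bounded \<phi>_subset by blast
  have disjoint: "disjoint_family_on (\<lambda>i. \<phi> (F i)) I" if "disjoint_family_on F I" for F and I :: "'i set"
    using that \<phi>_disjoint unfolding disjoint_family_on_def by blast
  show "point_process_on Y M (\<lambda>\<omega> A. N \<omega> (\<phi> A))"
  proof (rule point_process_onI)
    show "prob_space M" by (rule point_process_on_prob_space[OF P])
    show "(\<lambda>\<omega>. N \<omega> (\<phi> A)) \<in> measurable M (count_space UNIV)"
      if "A \<in> sets borel" "bounded A" "A \<subseteq> Y" for A
      using admissible[OF that] by (intro point_process_on_measurable[OF P]) auto
    show "N \<omega> (\<phi> {}) = 0" if "\<omega> \<in> space M" for \<omega>
      using \<phi>_disjoint[of "{}" "{}"] point_process_on_empty[OF P that] by simp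
    fix \<omega> and F :: "nat \<Rightarrow> _"
    assume \<omega>: "\<omega> \<in> space M" and F: "disjoint_family F" "range F \<subseteq> sets borel"
      "\<Union>(range F) \<subseteq> Y" "bounded (\<Union>(range F))"
    have "F n \<in> sets borel" "bounded (F n)" "F n \<subseteq> Y" for n
      using F by (auto intro: bounded_subset)
    then have "\<phi> (F n) \<in> sets borel" for n using admissible by blast
    moreover have "(\<Union>n. \<phi> (F n)) \<subseteq> X" "bounded (\<Union>n. \<phi> (F n))"
      using admissible[of "\<Union>(range F)"] F unfolding \<phi>_UN by auto
    ultimately have "(\<lambda>n. real (N \<omega> (\<phi> (F n)))) sums real (N \<omega> (\<Union>n. \<phi> (F n)))"
      using disjoint[OF F(1)] by (intro point_process_on_sums[OF P \<omega>]) auto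
    then show "(\<lambda>n. real (N \<omega> (\<phi> (F n)))) sums real (N \<omega> (\<phi> (\<Union>(range F))))"
      by (simp only: \<phi>_UN)
  qed
  fix l and A :: "nat \<Rightarrow> _"
  assume A: "\<And>i. i \<in> {1..l} \<Longrightarrow> A i \<in> sets borel \<and> bounded (A i) \<and> A i \<subseteq> Y"
    and "disjoint_family_on A {1..l}"
  then have "has_mgwd M a \<rho> l (\<lambda>i. k * \<nu> (\<phi> (A i))) (\<lambda>i \<omega>. N \<omega> (\<phi> (A i)))"
    using admissible disjoint by (intro gw_process_on_has_mgwd[OF N]) auto
  then show "has_mgwd M a \<rho> l (\<lambda>i. k * \<nu>' (A i)) (\<lambda>i \<omega>. N \<omega> (\<phi> (A i)))"
    by (rule has_mgwd_cong) (use A \<nu>' in auto)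
qed

lemma mark_measure_Times:
  assumes "S \<subseteq> {1..m}"
  shows "mark_measure m \<mu> (A \<times> real ` S) = real (card S) * measure \<mu> A"
proof -
  have "mark_measure m \<mu> (A \<times> real ` S) = (\<Sum>i\<in>{1..m}. if i \<in> S then measure \<mu> A else 0)"
    unfolding mark_measure_def by (intro sum.cong) (auto simp: image_iff)
  also have "\<dots> = (\<Sum>i\<in>S. measure \<mu> A)"
    using assms by (intro sum.mono_neutral_cong_right) auto
  finally show ?thesis by simp
qed

lemma bounded_borel_Times_marks:
  fixes A :: "'a::polish_space set"
  assumes "A \<in> sets borel" "bounded A" "S \<subseteq> {1..m}"
  shows "A \<times> real ` S \<in> sets borel \<and> bounded (A \<times> real ` S) \<and> A \<times> real ` S \<subseteq> UNIV \<times> real ` {1..m}"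
proof -
  have "finite (real ` S)" using assms(3) finite_subset by blast
  then have "real ` S \<in> sets borel" "bounded (real ` S)"
    by (simp_all add: borel_closed finite_imp_closed finite_imp_bounded)
  then show ?thesis
    using assms by (auto intro: Times_in_borel bounded_Times)
qed

definition relabel_marks :: "(nat \<Rightarrow> nat) \<Rightarrow> nat \<Rightarrow> ('a \<times> real) set \<Rightarrow> ('a \<times> real) set" where
  "relabel_marks idx l B = {(x, real (idx j)) | x j. (x, real j) \<in> B \<and> j \<in> {1..l}}"

lemma relabel_marks_eq_UN:
  "relabel_marks idx l B = (\<Union>j\<in>{1..l}. {x. (x, real j) \<in> B} \<times> {real (idx j)})"
  unfolding relabel_marks_def by auto

lemma relabel_marks_slice:
  assumes "inj_on idx {1..l}" "j \<in> {1..l}"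
  shows "{x. (x, real (idx j)) \<in> relabel_marks idx l B} = {x. (x, real j) \<in> B}"
  using assms unfolding relabel_marks_def by (auto simp: inj_on_eq_iff)

lemma relabel_marks_slice_empty:
  assumes "i \<notin> idx ` {1..l}"
  shows "{x. (x, real i) \<in> relabel_marks idx l B} = {}"
  using assms unfolding relabel_marks_def by auto

lemma mark_measure_relabel_marks:
  assumes "inj_on idx {1..l}" "idx ` {1..l} \<subseteq> {1..m}"
  shows "mark_measure m \<mu> (relabel_marks idx l B) = mark_measure l \<mu> B"
proof -
  have "mark_measure m \<mu> (relabel_marks idx l B)
      = (\<Sum>i\<in>idx ` {1..l}. measure \<mu> {x. (x, real i) \<in> relabel_marks idx l B})"
    unfolding mark_measure_def using assms(2)
    by (intro sum.mono_neutral_right) (auto simp: relabel_marks_slice_empty)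
  also have "\<dots> = (\<Sum>j\<in>{1..l}. measure \<mu> {x. (x, real (idx j)) \<in> relabel_marks idx l B})"
    using assms(1) by (simp add: sum.reindex)
  also have "\<dots> = mark_measure l \<mu> B"
    unfolding mark_measure_def using assms(1) by (intro sum.cong) (simp_all add: relabel_marks_slice)
  finally show ?thesis .
qed

lemma mgw_process_marginal:
  fixes N :: "'w \<Rightarrow> ('a::polish_space \<times> real) set \<Rightarrow> nat"
  assumes "mgw_process m M a k \<rho> \<mu> N" "S \<subseteq> {1..m}"
  shows "gw_process_on UNIV M a k \<rho> (\<lambda>A. real (card S) * measure \<mu> A) (\<lambda>\<omega> A. N \<omega> (A \<times> real ` S))"
proof (rule gw_process_on_set_map[OF assms(1)[unfolded mgw_process_def]])
  fix A :: "'a set"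
  assume "A \<in> sets borel" "bounded A"
  then show "A \<times> real ` S \<in> sets borel" "bounded (A \<times> real ` S)"
    and "A \<times> real ` S \<subseteq> UNIV \<times> real ` {1..m}"
    using bounded_borel_Times_marks[OF _ _ assms(2)] by blast+
  show "real (card S) * measure \<mu> A = mark_measure m \<mu> (A \<times> real ` S)"
    by (rule mark_measure_Times[OF assms(2), symmetric])
qed blast+

lemma mgw_process_count_Times:
  fixes N :: "'w \<Rightarrow> ('a::polish_space \<times> real) set \<Rightarrow> nat"
  assumes N: "mgw_process m M a k \<rho> \<mu> N" and "\<omega> \<in> space M" "S \<subseteq> {1..m}"
    and "A \<in> sets borel" "bounded A"
  shows "N \<omega> (A \<times> real ` S) = (\<Sum>i\<in>S. N \<omega> (A \<times> {real i}))"
proof -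
  have "A \<times> real ` S = (\<Union>i\<in>S. A \<times> real ` {i})" by auto
  moreover have "N \<omega> (\<Union>i\<in>S. A \<times> real ` {i}) = (\<Sum>i\<in>S. N \<omega> (A \<times> real ` {i}))"
  proof (rule point_process_on_finite_UN)
    show "point_process_on (UNIV \<times> real ` {1..m}) M N"
      using N unfolding mgw_process_def by (rule gw_process_on_point_process)
    show "finite S" using assms(3) finite_subset by blast
    show "disjoint_family_on (\<lambda>i. A \<times> real ` {i}) S"
      unfolding disjoint_family_on_def by auto
    show "A \<times> real ` {i} \<in> sets borel \<and> bounded (A \<times> real ` {i}) \<and> A \<times> real ` {i} \<subseteq> UNIV \<times> real ` {1..m}"
      if "i \<in> S" for i
      using that assms(3-5) by (intro bounded_borel_Times_marks) auto
  qed (rule assms(2))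
  ultimately show ?thesis by simp
qed

lemma mgw_process_has_mgwd:
  fixes N :: "'w \<Rightarrow> ('a::polish_space \<times> real) set \<Rightarrow> nat"
  assumes N: "mgw_process m M a k \<rho> \<mu> N"
    and A: "\<And>j. j \<in> {1..l} \<Longrightarrow> A j \<in> sets borel \<and> bounded (A j)"
    and S: "\<And>j. j \<in> {1..l} \<Longrightarrow> S j \<subseteq> {1..m}" and "disjoint_family_on S {1..l}"
  shows "has_mgwd M a \<rho> l (\<lambda>j. k * real (card (S j)) * measure \<mu> (A j)) (\<lambda>j \<omega>. N \<omega> (A j \<times> real ` S j))"
proof -
  have "has_mgwd M a \<rho> l (\<lambda>j. k * mark_measure m \<mu> (A j \<times> real ` S j)) (\<lambda>j \<omega>. N \<omega> (A j \<times> real ` S j))"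
  proof (rule gw_process_on_has_mgwd[OF N[unfolded mgw_process_def]])
    show "A j \<times> real ` S j \<in> sets borel \<and> bounded (A j \<times> real ` S j) \<and> A j \<times> real ` S j \<subseteq> UNIV \<times> real ` {1..m}"
      if "j \<in> {1..l}" for j
      using A[OF that] S[OF that] by (intro bounded_borel_Times_marks) auto
    show "disjoint_family_on (\<lambda>j. A j \<times> real ` S j) {1..l}"
      using \<open>disjoint_family_on S {1..l}\<close> unfolding disjoint_family_on_def by fastforce
  qed
  moreover have "k * real (card (S j)) * measure \<mu> (A j) = k * mark_measure m \<mu> (A j \<times> real ` S j)"
    if "j \<in> {1..l}" for j
    unfolding mark_measure_Times[OF S[OF that]] by simp
  ultimately show ?thesis by (rule has_mgwd_cong) auto
qed

lemma mgw_process_relabel_marks: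
  fixes N :: "'w \<Rightarrow> ('a::polish_space \<times> real) set \<Rightarrow> nat"
  assumes N: "mgw_process m M a k \<rho> \<mu> N"
    and idx: "inj_on idx {1..l}" "idx ` {1..l} \<subseteq> {1..m}"
  shows "mgw_process l M a k \<rho> \<mu> (\<lambda>\<omega> B. N \<omega> (relabel_marks idx l B))"
  unfolding mgw_process_def
proof (rule gw_process_on_set_map[OF N[unfolded mgw_process_def]])
  fix B :: "('a \<times> real) set"
  assume B: "B \<in> sets borel" "bounded B"
  show "relabel_marks idx l B \<in> sets borel"
    unfolding relabel_marks_eq_UN
    by (intro sets.finite_UN Times_in_borel Pair_slice_in_borel B(1)) auto
  have sub: "relabel_marks idx l B \<subseteq> fst ` B \<times> real ` {1..m}"
    using idx(2) unfolding relabel_marks_def by force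
  have "bounded (fst ` B \<times> real ` {1..m})"
    using bounded_fst[OF B(2)] by (rule bounded_Times) auto
  with sub show "bounded (relabel_marks idx l B)" by (rule bounded_subset[rotated])
  show "relabel_marks idx l B \<subseteq> UNIV \<times> real ` {1..m}" using sub by blast
  show "mark_measure l \<mu> B = mark_measure m \<mu> (relabel_marks idx l B)"
    by (rule mark_measure_relabel_marks[OF idx, symmetric])
next
  show "relabel_marks idx l A \<inter> relabel_marks idx l B = {}" if "A \<inter> B = {}" for A B
    using that idx(1) unfolding relabel_marks_def by (auto simp: inj_on_eq_iff)
  show "relabel_marks idx l (\<Union>(range F)) = (\<Union>n. relabel_marks idx l (F n))" for F :: "nat \<Rightarrow> _"
    unfolding relabel_marks_def by blast
qed

lemma mgw_process_superposition:
  fixes N :: "'w \<Rightarrow> ('a::polish_space \<times> real) set \<Rightarrow> nat"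
  assumes N: "mgw_process m M a k \<rho> \<mu> N"
    and idx: "inj_on idx {1..l}" "idx ` {1..l} \<subseteq> {1..m}"
  shows "gw_process_on UNIV M a k \<rho> (\<lambda>A. real l * measure \<mu> A)
           (\<lambda>\<omega> A. \<Sum>j\<in>{1..l}. N \<omega> (A \<times> {real (idx j)}))"
proof (rule gw_process_on_cong[OF mgw_process_marginal[OF N idx(2)]])
  fix \<omega> and A :: "'a set"
  assume "\<omega> \<in> space M" "A \<in> sets borel" "bounded A"
  from mgw_process_count_Times[OF N this(1) idx(2) this(2,3)]
  show "(\<Sum>j\<in>{1..l}. N \<omega> (A \<times> {real (idx j)})) = N \<omega> (A \<times> real ` idx ` {1..l})"
    unfolding sum.reindex[OF idx(1)] by simp
qed (unfold card_image[OF idx(1)], simp)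

lemma mgw_process_has_mgwd_components:
  fixes N :: "'w \<Rightarrow> ('a::polish_space \<times> real) set \<Rightarrow> nat"
  assumes N: "mgw_process m M a k \<rho> \<mu> N"
    and idx: "inj_on idx {1..l}" "idx ` {1..l} \<subseteq> {1..m}"
    and A: "\<forall>j\<in>{1..l}. A j \<in> sets borel \<and> bounded (A j)"
  shows "has_mgwd M a \<rho> l (\<lambda>j. k * measure \<mu> (A j)) (\<lambda>j \<omega>. N \<omega> (A j \<times> {real (idx j)}))"
proof -
  have "has_mgwd M a \<rho> l (\<lambda>j. k * real (card {idx j}) * measure \<mu> (A j))
      (\<lambda>j \<omega>. N \<omega> (A j \<times> real ` {idx j}))"
  proof (rule mgw_process_has_mgwd[OF N])
    show "disjoint_family_on (\<lambda>j. {idx j}) {1..l}"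
      using idx(1) unfolding disjoint_family_on_def inj_on_def by blast
  qed (use idx(2) A in \<open>auto simp: image_subset_iff\<close>)
  then show ?thesis by (rule has_mgwd_cong) simp_all
qed

lemma mgw_process_has_mgwd_component_rest:
  fixes N :: "'w \<Rightarrow> ('a::polish_space \<times> real) set \<Rightarrow> nat"
  assumes N: "mgw_process m M a k \<rho> \<mu> N" and i: "i \<in> {1..m}"
    and A: "A \<in> sets borel" "bounded A" and B: "B \<in> sets borel" "bounded B"
  shows "has_mgwd M a \<rho> 2
           (\<lambda>j. if j = 1 then k * measure \<mu> A else real (m - 1) * k * measure \<mu> B)
           (\<lambda>j \<omega>. if j = 1 then N \<omega> (A \<times> {real i}) else (\<Sum>j'\<in>{1..m} - {i}. N \<omega> (B \<times> {real j'})))"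
proof -
  let ?A = "\<lambda>j::nat. if j = 1 then A else B"
  let ?S = "\<lambda>j::nat. if j = 1 then {i} else {1..m} - {i}"
  have marked: "has_mgwd M a \<rho> 2 (\<lambda>j. k * real (card (?S j)) * measure \<mu> (?A j))
      (\<lambda>j \<omega>. N \<omega> (?A j \<times> real ` ?S j))"
  proof (rule mgw_process_has_mgwd[OF N])
    show "?A j \<in> sets borel \<and> bounded (?A j)" for j using A B by simp
    show "?S j \<subseteq> {1..m}" for j using i by simp
    show "disjoint_family_on ?S {1..2}" unfolding disjoint_family_on_def by simp
  qed
  have count: "N \<omega> (B \<times> real ` ({1..m} - {i})) = (\<Sum>j'\<in>{1..m} - {i}. N \<omega> (B \<times> {real j'}))"
    if "\<omega> \<in> space M" for \<omega>
    by (rule mgw_process_count_Times[OF N that Diff_subset B])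
  have card: "card ({1..m} - {i}) = m - 1" using i by simp
  have two: "j = 1 \<or> j = 2" if "j \<in> {1..2::nat}" for j using that by auto
  show ?thesis
    by (rule has_mgwd_cong[OF marked]) (use two count card in auto)
qed

theorem theorem11:
  fixes M :: "'w measure" and \<mu> :: "'a::polish_space measure"
    and N :: "'w \<Rightarrow> ('a \<times> real) set \<Rightarrow> nat"
    and m :: nat and a k \<rho> :: real
  assumes mu_borel: "sets \<mu> = sets borel"
    and mu_bfin: "\<forall>A\<in>sets borel. bounded A \<longrightarrow> emeasure \<mu> A < \<infinity>"
    and m2: "m \<ge> 2" and a_pos: "a > 0" and rho_pos: "\<rho> > 0" and k_pos: "k > 0"
    and N: "mgw_process m M a k \<rho> \<mu> N"
  shows
    "(\<forall>i\<in>{1..m}. gw_process_on UNIV M a k \<rho> (measure \<mu>) (\<lambda>\<omega> A. N \<omega> (A \<times> {real i})))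
   \<and> (\<forall>(l::nat) (idx :: nat \<Rightarrow> nat). inj_on idx {1..l} \<and> idx ` {1..l} \<subseteq> {1..m} \<longrightarrow>
        gw_process_on UNIV M a k \<rho> (\<lambda>A. real l * measure \<mu> A)
          (\<lambda>\<omega> A. \<Sum>j\<in>{1..l}. N \<omega> (A \<times> {real (idx j)})))
   \<and> (\<forall>(l::nat) (idx :: nat \<Rightarrow> nat). inj_on idx {1..l} \<and> idx ` {1..l} \<subseteq> {1..m} \<longrightarrow>
        mgw_process l M a k \<rho> \<mu>
          (\<lambda>\<omega> B. N \<omega> {(x, real (idx j)) | x j. (x, real j) \<in> B \<and> j \<in> {1..l}})
        \<and> (\<forall>A :: nat \<Rightarrow> 'a set. (\<forall>j\<in>{1..l}. A j \<in> sets borel \<and> bounded (A j)) \<longrightarrow>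
             has_mgwd M a \<rho> l (\<lambda>j. k * measure \<mu> (A j)) (\<lambda>j \<omega>. N \<omega> (A j \<times> {real (idx j)}))))
   \<and> (\<forall>i\<in>{1..m}. \<forall>A B. A \<in> sets borel \<and> bounded A \<and> B \<in> sets borel \<and> bounded B \<longrightarrow>
        has_mgwd M a \<rho> 2
          (\<lambda>j. if j = 1 then k * measure \<mu> A else real (m - 1) * k * measure \<mu> B)
          (\<lambda>j \<omega>. if j = 1 then N \<omega> (A \<times> {real i}) else (\<Sum>j'\<in>{1..m} - {i}. N \<omega> (B \<times> {real j'}))))"
proof -
  have "gw_process_on UNIV M a k \<rho> (measure \<mu>) (\<lambda>\<omega> A. N \<omega> (A \<times> {real i}))" if "i \<in> {1..m}" for i
    using mgw_process_marginal[OF N, of "{i}"] that by simp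
  then show ?thesis
    using mgw_process_superposition[OF N] mgw_process_relabel_marks[OF N, unfolded relabel_marks_def]
      mgw_process_has_mgwd_components[OF N] mgw_process_has_mgwd_component_rest[OF N]
    by (intro conjI ballI allI impI; (elim conjE)?; blast)
qed

end
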